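(* Let $\Theta$ be a substitution schema and $\mathcal{U}$ a finite set of unification equations. If $\mathrm{store}_\Theta(\mathcal{U})\neq\bot$, then $\mathcal{U}$ is unifiable (in the usual syntactic first-order sense).
   Context: Variables are objects $X_i$ with $X$ from a countably infinite set $\mathcal{V}_{sym}$ of variable symbols and $i\in\mathbb{N}$; terms are first-order terms over a signature $\Sigma$ and these variables; $\mathrm{cls}(X_i)=\{X\}$. $\mathrm{shift}_d$ adds $d$ to every variable index in a term. A substitution schema $\Theta$ is given by pairwise distinct symbols $X^1,\dots,X^n$ and terms $t_1,\dots,t_n$, and is the infinite mapping $\{X^i_j\mapsto\mathrm{shift}_j(t_i)\mid 1\le i\le n, j\ge0\}$, with $\mathrm{dom}(\Theta)=\{X^1,\dots,X^n\}$. For a variable $x$ write $x\in\Theta$ if $\mathrm{cls}(x)\subseteq\mathrm{dom}(\Theta)$, and $x\notin\Theta$ otherwise. For a term $t$, $\Theta^t$ is the substitution sending each variable $x$ of $t$ with $x\in\Theta$ to its image under $\Theta$ and fixing all other variables; $\Theta^t(0)=t$ and $\Theta^t(k+1)=s\Theta^s$ with $s=\Theta^t(k)$. $\Theta$-unification. A configuration is a pair $(\mathcal{S},\mathcal{U})$ of sets of equations (store, active set). Starting from $(\emptyset,\mathcal{U})$, the procedure first saturates the active set under: Decomposition (replace $f(r_1,\dots,r_n)\stackrel{?}{=}f(s_1,\dots,s_n)$ by the $r_i\stackrel{?}{=}s_i$); Orient-1 (replace $r\stackrel{?}{=}x$, $x$ a variable, $r$ not a variable, by $x\stackrel{?}{=}r$);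 Orient-2 (for variables, if $y\stackrel{?}{=}x$ is present and $x\stackrel{?}{=}y$ not, add $x\stackrel{?}{=}y$); Transitivity (from $x\stackrel{?}{=}r$, $x\stackrel{?}{=}s$, $x$ a variable, $r\ne s$, add $r\stackrel{?}{=}s$); Reflexive (remove $t\stackrel{?}{=}t$); Clash (an equation between non-variable terms with different heads makes the procedure fail). Then Store is applied as long as possible, moving $y\stackrel{?}{=}r$ ($y$ a variable) from the active set to the store if (1) $y\in\Theta$ and, if $r$ is a variable, $r\in\Theta$; or (2) $y\notin\Theta$ and some $x\stackrel{?}{=}s'$ in the store has $y$ occurring in $s'$, or $r=x$, or $y=x$; or (3) $y\notin\Theta$ and for some variable $z\in\Theta$ occurring in the store and some $k\ge0$, $y$ occurs in $\Theta^z(k)$. Finally syntactic unification is run on store $\cup$ active set and the procedure fails if it fails (clash or occurs check). The resulting configuration is the final configuration $\mathrm{fin}_\Theta(\mathcal{U})$ and its store is $\mathrm{store}_\Theta(\mathcal{U})$; if the procedure fails, $\mathrm{store}_\Theta(\mathcal{U})=\bot$. *)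

theory Defs
  imports
    "HOL-Library.Countable"
    "HOL-Library.Infinite_Typeclass"
begin

type_synonym 'v var = "'v \<times> nat"

datatype ('f, 'v) trm =
    Var "'v var"
  | Fun 'f "('f, 'v) trm list"

text \<open>A signature is a type \<open>'f\<close> of function symbols with an arity function.\<close>

fun wf_trm :: "('f \<Rightarrow> nat) \<Rightarrow> ('f, 'v) trm \<Rightarrow> bool" where
  "wf_trm ar (Var x) \<longleftrightarrow> True"
| "wf_trm ar (Fun f ts) \<longleftrightarrow> length ts = ar f \<and> (\<forall>t \<in> set ts. wf_trm ar t)"

fun is_Var :: "('f, 'v) trm \<Rightarrow> bool" where
  "is_Var (Var x) \<longleftrightarrow> True"
| "is_Var (Fun f ts) \<longleftrightarrow> False"

fun vars :: "('f, 'v) trm \<Rightarrow> 'v var set" where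
  "vars (Var x) = {x}"
| "vars (Fun f ts) = (\<Union>t \<in> set ts. vars t)"

fun subst :: "('f, 'v) trm \<Rightarrow> ('v var \<Rightarrow> ('f, 'v) trm) \<Rightarrow> ('f, 'v) trm" (infixl "\<cdot>" 67) where
  "Var x \<cdot> \<sigma> = \<sigma> x"
| "Fun f ts \<cdot> \<sigma> = Fun f (map (\<lambda>t. t \<cdot> \<sigma>) ts)"

definition is_subst :: "('f \<Rightarrow> nat) \<Rightarrow> ('v var \<Rightarrow> ('f, 'v) trm) \<Rightarrow> bool" where
  "is_subst ar \<sigma> \<longleftrightarrow> finite {x. \<sigma> x \<noteq> Var x} \<and> (\<forall>x. wf_trm ar (\<sigma> x))"

text \<open>An equation is an ordered pair of terms.\<close>

type_synonym ('f, 'v) eqn = "('f, 'v) trm \<times> ('f, 'v) trm"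
type_synonym ('f, 'v) eqns = "('f, 'v) eqn set"

definition eqns_over :: "('f \<Rightarrow> nat) \<Rightarrow> ('f, 'v) eqns \<Rightarrow> bool" where
  "eqns_over ar U \<longleftrightarrow> (\<forall>(r, s) \<in> U. wf_trm ar r \<and> wf_trm ar s)"

definition eqns_vars :: "('f, 'v) eqns \<Rightarrow> 'v var set" where
  "eqns_vars U = (\<Union>(r, s) \<in> U. vars r \<union> vars s)"

definition unifiable :: "('f \<Rightarrow> nat) \<Rightarrow> ('f, 'v) eqns \<Rightarrow> bool" where
  "unifiable ar U \<longleftrightarrow> (\<exists>\<sigma>. is_subst ar \<sigma> \<and> (\<forall>(r, s) \<in> U. r \<cdot> \<sigma> = s \<cdot> \<sigma>))"


subsection \<open>Substitution schemata\<close>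

definition cls :: "'v var \<Rightarrow> 'v set" where
  "cls x = {fst x}"

definition shift :: "nat \<Rightarrow> ('f, 'v) trm \<Rightarrow> ('f, 'v) trm" where
  "shift d t = t \<cdot> (\<lambda>(X, i). Var (X, i + d))"

text \<open>
  The schema with symbols \<open>X\<^sup>1, \<dots>, X\<^sup>n\<close> and terms \<open>t\<^sub>1, \<dots>, t\<^sub>n\<close> is the finite
  map sending \<open>X\<^sup>i\<close> to \<open>t\<^sub>i\<close>.
\<close>

type_synonym ('f, 'v) schema = "'v \<rightharpoonup> ('f, 'v) trm"

definition subst_schema :: "('f \<Rightarrow> nat) \<Rightarrow> ('f, 'v) schema \<Rightarrow> bool" where
  "subst_schema ar \<Theta> \<longleftrightarrow> finite (dom \<Theta>) \<and> (\<forall>t \<in> ran \<Theta>. wf_trm ar t)"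

definition in_schema :: "'v var \<Rightarrow> ('f, 'v) schema \<Rightarrow> bool" where
  "in_schema x \<Theta> \<longleftrightarrow> cls x \<subseteq> dom \<Theta>"

definition schema_image :: "('f, 'v) schema \<Rightarrow> 'v var \<Rightarrow> ('f, 'v) trm" where
  "schema_image \<Theta> x = shift (snd x) (the (\<Theta> (fst x)))"

definition schema_subst :: "('f, 'v) schema \<Rightarrow> ('f, 'v) trm \<Rightarrow> 'v var \<Rightarrow> ('f, 'v) trm" where
  "schema_subst \<Theta> t x =
    (if x \<in> vars t \<and> in_schema x \<Theta> then schema_image \<Theta> x else Var x)"

fun schema_iter :: "('f, 'v) schema \<Rightarrow> ('f, 'v) trm \<Rightarrow> nat \<Rightarrow> ('f, 'v) trm" where
  "schema_iter \<Theta> t 0 = t"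
| "schema_iter \<Theta> t (Suc k) = (let s = schema_iter \<Theta> t k in s \<cdot> schema_subst \<Theta> s)"


subsection \<open>Syntactic unification\<close>

text \<open>
  On well-formed terms, different lengths of the argument lists imply different heads.
\<close>

definition clash :: "('f, 'v) eqns \<Rightarrow> bool" where
  "clash U \<longleftrightarrow> (\<exists>f rs g ss. (Fun f rs, Fun g ss) \<in> U \<and> (f, length rs) \<noteq> (g, length ss))"

definition occurs_check :: "('f, 'v) eqns \<Rightarrow> bool" where
  "occurs_check U \<longleftrightarrow> (\<exists>x t. (Var x, t) \<in> U \<and> t \<noteq> Var x \<and> x \<in> vars t)"

text \<open>The Martelli--Montanari transformation rules.\<close>

inductive synt_step :: "('f, 'v) eqns \<Rightarrow> ('f, 'v) eqns \<Rightarrow> bool" where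
  Delete:
    "(t, t) \<in> E \<Longrightarrow> synt_step E (E - {(t, t)})"
| Decompose:
    "(Fun f rs, Fun f ss) \<in> E \<Longrightarrow> length rs = length ss \<Longrightarrow>
     synt_step E (E - {(Fun f rs, Fun f ss)} \<union> set (zip rs ss))"
| Swap:
    "(r, Var x) \<in> E \<Longrightarrow> \<not> is_Var r \<Longrightarrow>
     synt_step E (E - {(r, Var x)} \<union> {(Var x, r)})"
| Eliminate:
    "(Var x, t) \<in> E \<Longrightarrow> x \<notin> vars t \<Longrightarrow> x \<in> eqns_vars (E - {(Var x, t)}) \<Longrightarrow>
     synt_step E (insert (Var x, t)
       ((\<lambda>(r, s). (r \<cdot> Var(x := t), s \<cdot> Var(x := t))) ` (E - {(Var x, t)})))"

definition synt_unif_fails :: "('f, 'v) eqns \<Rightarrow> bool" where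
  "synt_unif_fails E \<longleftrightarrow> (\<exists>E'. synt_step\<^sup>*\<^sup>* E E' \<and> (clash E' \<or> occurs_check E'))"


subsection \<open>\<open>\<Theta>\<close>-unification\<close>

text \<open>Saturation acts on the active set only.\<close>

inductive basic_step :: "('f, 'v) eqns \<Rightarrow> ('f, 'v) eqns \<Rightarrow> bool" where
  Decomposition:
    "(Fun f rs, Fun f ss) \<in> U \<Longrightarrow> length rs = length ss \<Longrightarrow>
     basic_step U (U - {(Fun f rs, Fun f ss)} \<union> set (zip rs ss))"
| Orient_1:
    "(r, Var x) \<in> U \<Longrightarrow> \<not> is_Var r \<Longrightarrow>
     basic_step U (U - {(r, Var x)} \<union> {(Var x, r)})"
| Orient_2:
    "(Var y, Var x) \<in> U \<Longrightarrow> (Var x, Var y) \<notin> U \<Longrightarrow>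
     basic_step U (insert (Var x, Var y) U)"
| Reflexive:
    "(t, t) \<in> U \<Longrightarrow> basic_step U (U - {(t, t)})"

inductive trans_step :: "('f, 'v) eqns \<Rightarrow> ('f, 'v) eqns \<Rightarrow> bool" where
  Transitivity:
    "(Var x, r) \<in> U \<Longrightarrow> (Var x, s) \<in> U \<Longrightarrow> r \<noteq> s \<Longrightarrow>
     trans_step U (insert (r, s) U)"

definition sat_step :: "('f, 'v) eqns \<Rightarrow> ('f, 'v) eqns \<Rightarrow> bool" where
  "sat_step U V \<longleftrightarrow> basic_step U V \<or> trans_step U V"

text \<open>
  The equation added by Transitivity may be consumed at once by Decomposition or
  Orient-1, after which Transitivity would add it again: from \<open>x = f(y)\<close> and
  \<open>x = f(z)\<close> one obtains \<open>f(y) = f(z)\<close> over and over. Saturation is therefore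
  understood up to such repetitions: a Transitivity step need not be performed if the
  other rules merely lead back to the set it was applied to.
\<close>

definition saturated :: "('f, 'v) eqns \<Rightarrow> bool" where
  "saturated U \<longleftrightarrow>
    \<not> clash U \<and>
    (\<nexists>V. basic_step U V) \<and>
    (\<forall>V. trans_step U V \<longrightarrow> basic_step\<^sup>*\<^sup>* V U)"

text \<open>A configuration consists of the store and the active set.\<close>

type_synonym ('f, 'v) config = "('f, 'v) eqns \<times> ('f, 'v) eqns"

definition storable ::
    "('f, 'v) schema \<Rightarrow> ('f, 'v) eqns \<Rightarrow> 'v var \<Rightarrow> ('f, 'v) trm \<Rightarrow> bool" where
  "storable \<Theta> S y r \<longleftrightarrow>
    (in_schema y \<Theta> \<and> (\<forall>z. r = Var z \<longrightarrow> in_schema z \<Theta>)) \<or>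
    (\<not> in_schema y \<Theta> \<and>
      (\<exists>x s'. (Var x, s') \<in> S \<and> (y \<in> vars s' \<or> r = Var x \<or> y = x))) \<or>
    (\<not> in_schema y \<Theta> \<and>
      (\<exists>z k. in_schema z \<Theta> \<and> z \<in> eqns_vars S \<and> y \<in> vars (schema_iter \<Theta> (Var z) k)))"

inductive store_step :: "('f, 'v) schema \<Rightarrow> ('f, 'v) config \<Rightarrow> ('f, 'v) config \<Rightarrow> bool"
  for \<Theta> where
  Store:
    "(Var y, r) \<in> U \<Longrightarrow> storable \<Theta> S y r \<Longrightarrow>
     store_step \<Theta> (S, U) (insert (Var y, r) S, U - {(Var y, r)})"

text \<open>\<open>None\<close> is the failure value \<open>\<bottom>\<close>.\<close>

inductive theta_outcome ::
    "('f, 'v) schema \<Rightarrow> ('f, 'v) eqns \<Rightarrow> ('f, 'v) config option \<Rightarrow> bool"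
  for \<Theta> U where
  Clash:
    "sat_step\<^sup>*\<^sup>* U V \<Longrightarrow> clash V \<Longrightarrow> theta_outcome \<Theta> U None"
| Synt_fail:
    "sat_step\<^sup>*\<^sup>* U V \<Longrightarrow> saturated V \<Longrightarrow>
     (store_step \<Theta>)\<^sup>*\<^sup>* ({}, V) (S, A) \<Longrightarrow> (\<nexists>C. store_step \<Theta> (S, A) C) \<Longrightarrow>
     synt_unif_fails (S \<union> A) \<Longrightarrow> theta_outcome \<Theta> U None"
| Success:
    "sat_step\<^sup>*\<^sup>* U V \<Longrightarrow> saturated V \<Longrightarrow>
     (store_step \<Theta>)\<^sup>*\<^sup>* ({}, V) (S, A) \<Longrightarrow> (\<nexists>C. store_step \<Theta> (S, A) C) \<Longrightarrow>
     \<not> synt_unif_fails (S \<union> A) \<Longrightarrow> theta_outcome \<Theta> U (Some (S, A))"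

text \<open>
  The order of rule applications is left open, but it does not affect the outcome for
  finite sets of equations, so any outcome can be selected.
\<close>

definition fin :: "('f, 'v) schema \<Rightarrow> ('f, 'v) eqns \<Rightarrow> ('f, 'v) config option" where
  "fin \<Theta> U = (SOME C. theta_outcome \<Theta> U C)"

definition store :: "('f, 'v) schema \<Rightarrow> ('f, 'v) eqns \<Rightarrow> ('f, 'v) eqns option" where
  "store \<Theta> U = map_option fst (fin \<Theta> U)"

end

theory Submission
  imports Defs
begin

text \<open>
  Every rule of the procedure reflects unifiers, and Store does not change the union of store
  and active set. Hence it suffices that the final syntactic check is complete: a finite set from
  which Martelli--Montanari steps reach neither a clash nor an occurs-check failure is
  unifiable. Since \<open>fin\<close> selects an arbitrary outcome, one also has to know that an outcome
  exists. All equations produced by saturation relate subterms of the input, so a set that is normal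
  under the rules other than Transitivity can be properly enlarged by Transitivity only
  finitely often.
\<close>

section \<open>Unifiers\<close>

definition unifies :: "('v var \<Rightarrow> ('f, 'v) trm) \<Rightarrow> ('f, 'v) eqns \<Rightarrow> bool" where
  "unifies \<sigma> E \<longleftrightarrow> (\<forall>(r, s) \<in> E. r \<cdot> \<sigma> = s \<cdot> \<sigma>)"

lemma unifiable_iff_unifies: "unifiable ar E \<longleftrightarrow> (\<exists>\<sigma>. is_subst ar \<sigma> \<and> unifies \<sigma> E)"
  by (simp add: unifiable_def unifies_def)

lemma unifies_mono: "unifies \<sigma> F \<Longrightarrow> E \<subseteq> F \<Longrightarrow> unifies \<sigma> E"
  by (auto simp: unifies_def)

lemma unifies_insert: "unifies \<sigma> (insert (r, s) E) \<longleftrightarrow> r \<cdot> \<sigma> = s \<cdot> \<sigma> \<and> unifies \<sigma> E"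
  by (auto simp: unifies_def)

lemma unifies_zip:
  assumes "length rs = length ss" "unifies \<sigma> (set (zip rs ss))"
  shows "Fun f rs \<cdot> \<sigma> = Fun f ss \<cdot> \<sigma>"
  using assms by (induction rs ss rule: list_induct2) (auto simp: unifies_insert)

text \<open>Serves every rule that deletes an equation: with it, only the deleted equation has to be
  recovered from its replacement \<open>F\<close>.\<close>

lemma unifies_Diff:
  assumes "unifies \<sigma> (E - {(r, s)} \<union> F)" "r \<cdot> \<sigma> = s \<cdot> \<sigma>"
  shows "unifies \<sigma> E"
  using assms by (auto simp: unifies_def)

lemma subst_cong: "(\<And>x. x \<in> vars t \<Longrightarrow> \<sigma> x = \<tau> x) \<Longrightarrow> t \<cdot> \<sigma> = t \<cdot> \<tau>"
  by (induction t) auto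

lemma subst_subst: "t \<cdot> \<tau> \<cdot> \<sigma> = t \<cdot> (\<lambda>x. \<tau> x \<cdot> \<sigma>)"
  by (induction t) auto

lemma subst_Var: "t \<cdot> Var = t"
  by (induction t) (auto simp: map_idI)

lemma vars_subst: "vars (t \<cdot> \<sigma>) = (\<Union>x \<in> vars t. vars (\<sigma> x))"
  by (induction t) auto

lemma wf_trm_subst: "wf_trm ar t \<Longrightarrow> (\<And>x. wf_trm ar (\<sigma> x)) \<Longrightarrow> wf_trm ar (t \<cdot> \<sigma>)"
  by (induction t) auto

lemma finite_vars: "finite (vars t)"
  by (induction t) auto

lemma finite_eqns_vars: "finite E \<Longrightarrow> finite (eqns_vars E)"
  by (auto simp: eqns_vars_def finite_vars)

lemma eqns_vars_mono: "E \<subseteq> F \<Longrightarrow> eqns_vars E \<subseteq> eqns_vars F"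
  by (auto simp: eqns_vars_def)

lemma eqns_vars_Un: "eqns_vars (E \<union> F) = eqns_vars E \<union> eqns_vars F"
  by (auto simp: eqns_vars_def)

lemma eqns_vars_insert: "eqns_vars (insert (r, s) E) = vars r \<union> vars s \<union> eqns_vars E"
  by (auto simp: eqns_vars_def)

lemma eqns_vars_zip: "eqns_vars (set (zip rs ss)) \<subseteq> vars (Fun f rs) \<union> vars (Fun f ss)"
  by (auto simp: eqns_vars_def dest: set_zip_leftD set_zip_rightD)

lemma eqns_vars_memD: "(r, s) \<in> E \<Longrightarrow> vars r \<union> vars s \<subseteq> eqns_vars E"
  by (auto simp: eqns_vars_def)

section \<open>Saturation steps: unifiers, well-formedness, finiteness\<close>

lemma basic_step_unifies: "basic_step U V \<Longrightarrow> unifies \<sigma> V \<Longrightarrow> unifies \<sigma> U"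
proof (induction rule: basic_step.induct)
  case (Decomposition f rs ss U)
  then show ?case
    by (metis unifies_Diff unifies_zip unifies_mono Un_upper2)
next
  case (Orient_1 r x U)
  then have "r \<cdot> \<sigma> = Var x \<cdot> \<sigma>"
    by (simp add: unifies_insert)
  with Orient_1.prems show ?case
    by (rule unifies_Diff)
next
  case (Reflexive t U)
  then show ?case
    by (auto intro: unifies_Diff[where F = "{}"])
qed (auto simp: unifies_insert)

lemma trans_step_unifies: "trans_step U V \<Longrightarrow> unifies \<sigma> V \<Longrightarrow> unifies \<sigma> U"
  by (induction rule: trans_step.induct) (auto simp: unifies_insert)

lemma sat_steps_unifies: "sat_step\<^sup>*\<^sup>* U V \<Longrightarrow> unifies \<sigma> V \<Longrightarrow> unifies \<sigma> U"
  by (induction rule: converse_rtranclp_induct)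
    (auto simp: sat_step_def dest: basic_step_unifies trans_step_unifies)

lemma eqns_over_zip:
  assumes "wf_trm ar (Fun f rs)" "wf_trm ar (Fun f ss)"
  shows "eqns_over ar (set (zip rs ss))"
  using assms by (auto simp: eqns_over_def dest: set_zip_leftD set_zip_rightD)

text \<open>Shared by saturation and syntactic unification, which decompose equations in the same
  way.\<close>

lemma eqns_over_decompose:
  assumes "eqns_over ar E" "(Fun f rs, Fun f ss) \<in> E"
  shows "eqns_over ar (E - {(Fun f rs, Fun f ss)} \<union> set (zip rs ss))"
proof -
  have "eqns_over ar (set (zip rs ss))"
    using assms by (intro eqns_over_zip[of ar f]) (auto simp: eqns_over_def)
  then show ?thesis
    using assms(1) by (auto simp: eqns_over_def)
qed

lemma basic_step_eqns_over: "basic_step U V \<Longrightarrow> eqns_over ar U \<Longrightarrow> eqns_over ar V"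
proof (induction rule: basic_step.induct)
  case (Decomposition f rs ss U)
  then show ?case by (blast intro: eqns_over_decompose)
qed (auto simp: eqns_over_def)

lemma sat_steps_eqns_over: "sat_step\<^sup>*\<^sup>* U V \<Longrightarrow> eqns_over ar U \<Longrightarrow> eqns_over ar V"
proof (induction rule: rtranclp_induct)
  case (step V W)
  have "eqns_over ar W" if "trans_step V W"
    using that step by (cases rule: trans_step.cases) (auto simp: eqns_over_def)
  with step show ?case
    by (auto simp: sat_step_def intro: basic_step_eqns_over)
qed

lemma sat_step_finite: "sat_step U V \<Longrightarrow> finite U \<Longrightarrow> finite V"
  unfolding sat_step_def by (auto elim!: basic_step.cases trans_step.cases)

lemma sat_steps_finite: "sat_step\<^sup>*\<^sup>* U V \<Longrightarrow> finite U \<Longrightarrow> finite V"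
  by (induction rule: rtranclp_induct) (auto dest: sat_step_finite)

section \<open>Completeness of syntactic unification\<close>

lemma synt_step_unifies: "synt_step E F \<Longrightarrow> unifies \<sigma> F \<Longrightarrow> unifies \<sigma> E"
proof (induction rule: synt_step.induct)
  case (Delete t E)
  then show ?case
    by (auto intro: unifies_Diff[where F = "{}"])
next
  case (Decompose f rs ss E)
  then show ?case
    by (metis unifies_Diff unifies_zip unifies_mono Un_upper2)
next
  case (Swap r x E)
  then have "r \<cdot> \<sigma> = Var x \<cdot> \<sigma>"
    by (simp add: unifies_insert)
  with Swap.prems show ?case
    by (rule unifies_Diff)
next
  case (Eliminate x t E)
  have x: "\<sigma> x = t \<cdot> \<sigma>"
    using Eliminate.prems by (simp add: unifies_insert)
  \<comment> \<open>Since \<sigma> already identifies x with t, replacing x by t before applying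
    \<sigma> changes nothing.\<close>
  have elim: "r \<cdot> Var(x := t) \<cdot> \<sigma> = r \<cdot> \<sigma>" for r
    unfolding subst_subst by (rule subst_cong) (simp add: x)
  have rest: "unifies \<sigma> (E - {(Var x, t)})"
    unfolding unifies_def
  proof (rule ballI, rule case_prodI2)
    fix e r s assume e: "e \<in> E - {(Var x, t)}" "e = (r, s)"
    have "\<forall>e \<in> E - {(Var x, t)}. fst e \<cdot> Var(x := t) \<cdot> \<sigma> = snd e \<cdot> Var(x := t) \<cdot> \<sigma>"
      using Eliminate.prems by (simp add: unifies_def case_prod_unfold)
    from bspec[OF this e(1)] have "r \<cdot> Var(x := t) \<cdot> \<sigma> = s \<cdot> Var(x := t) \<cdot> \<sigma>"
      by (simp only: e(2) fst_conv snd_conv)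
    then show "r \<cdot> \<sigma> = s \<cdot> \<sigma>"
      by (simp only: elim)
  qed
  show ?case
    by (rule unifies_Diff[where r = "Var x" and s = t and F = "{}"]) (simp_all add: x rest)
qed

lemma synt_step_eqns_over: "synt_step E F \<Longrightarrow> eqns_over ar E \<Longrightarrow> eqns_over ar F"
proof (induction rule: synt_step.induct)
  case (Decompose f rs ss E)
  then show ?case by (blast intro: eqns_over_decompose)
next
  case (Eliminate x t E)
  have t: "wf_trm ar t"
    using Eliminate by (auto simp: eqns_over_def)
  have "wf_trm ar (r \<cdot> Var(x := t))" if "wf_trm ar r" for r
    using that t by (intro wf_trm_subst) auto
  with Eliminate t show ?case
    by (auto simp: eqns_over_def)
qed (auto simp: eqns_over_def)

text \<open>Used contrapositively: not failing is inherited along steps, so it can serve as an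
  invariant of the completeness induction.\<close>

lemma synt_unif_fails_step: "synt_step E F \<Longrightarrow> synt_unif_fails F \<Longrightarrow> synt_unif_fails E"
  unfolding synt_unif_fails_def by (meson converse_rtranclp_into_rtranclp)

lemma synt_unif_failsI: "clash E \<or> occurs_check E \<Longrightarrow> synt_unif_fails E"
  unfolding synt_unif_fails_def by blast

section \<open>A termination weight for sets of equations\<close>

fun trm_size :: "('f, 'v) trm \<Rightarrow> nat" where
  "trm_size (Var x) = 1"
| "trm_size (Fun f ts) = 2 + sum_list (map trm_size ts)"

text \<open>The asymmetry makes orienting an equation decrease the weight.\<close>

fun eqn_weight :: "('f, 'v) eqn \<Rightarrow> nat" where
  "eqn_weight (r, s) = 2 * trm_size r + trm_size s"

definition eqns_weight :: "('f, 'v) eqns \<Rightarrow> nat" where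
  "eqns_weight E = sum eqn_weight E"

lemma trm_size_pos: "0 < trm_size t"
  by (cases t) auto

text \<open>Members of \<open>F\<close> may already be present in the rest of \<open>E\<close>; such
  overlaps only make the union lighter.\<close>

lemma eqns_weight_replace:
  assumes "finite E" "e \<in> E" "finite F" "eqns_weight F < eqn_weight e"
  shows "eqns_weight (E - {e} \<union> F) < eqns_weight E"
proof -
  have "eqns_weight (E - {e} \<union> F) \<le> eqns_weight (E - {e}) + eqns_weight F"
    unfolding eqns_weight_def using assms by (simp add: sum_Un_nat)
  also have "\<dots> < eqns_weight (E - {e}) + eqn_weight e"
    using assms by simp
  also have "\<dots> = eqns_weight E"
    unfolding eqns_weight_def using assms by (simp add: sum.remove)
  finally show ?thesis .
qed

lemma sum_set_le_sum_list:
  fixes f :: "'a \<Rightarrow> nat"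
  shows "sum f (set xs) \<le> sum_list (map f xs)"
  by (induction xs) (auto simp: sum.insert_if)

lemma eqns_weight_zip:
  assumes "length rs = length ss"
  shows "eqns_weight (set (zip rs ss)) < eqn_weight (Fun f rs, Fun f ss)"
proof -
  have "eqns_weight (set (zip rs ss)) \<le> sum_list (map eqn_weight (zip rs ss))"
    unfolding eqns_weight_def by (rule sum_set_le_sum_list)
  also have "\<dots> = 2 * sum_list (map trm_size rs) + sum_list (map trm_size ss)"
    using assms by (induction rs ss rule: list_induct2) auto
  finally show ?thesis by simp
qed

lemma eqns_weight_remove:
  assumes "finite E" "e \<in> E"
  shows "eqns_weight (E - {e}) < eqns_weight E"
proof -
  have "0 < eqn_weight e"
    using trm_size_pos by (cases e) auto
  then show ?thesis
    using eqns_weight_replace[of E e "{}"] assms by (simp add: eqns_weight_def)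
qed

section \<open>Solved forms and elimination of a variable\<close>

definition solved_wrt :: "('f, 'v) eqns \<Rightarrow> ('f, 'v) eqns \<Rightarrow> bool" where
  "solved_wrt P R \<longleftrightarrow> (\<forall>(l, r) \<in> P. \<exists>x. l = Var x \<and> x \<notin> vars r \<and>
     x \<notin> eqns_vars (P - {(l, r)}) \<and> x \<notin> eqns_vars R)"

lemma solved_wrt_mono: "solved_wrt P R \<Longrightarrow> eqns_vars R' \<subseteq> eqns_vars R \<Longrightarrow> solved_wrt P R'"
  unfolding solved_wrt_def by fast

text \<open>A common equation would put its own left-hand variable into \<open>R\<close>.
  Disjointness is what turns the deletion of a member of \<open>R\<close> from the union into a
  deletion from \<open>R\<close> alone.\<close>

lemma solved_wrt_disjoint: "solved_wrt P R \<Longrightarrow> P \<inter> R = {}"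
  by (fastforce simp: solved_wrt_def eqns_vars_def)

text \<open>A solved set can be read as a substitution. No left-hand variable occurs in a right-hand
  side, so this substitution fixes every right-hand side and is therefore a unifier.\<close>

lemma solved_unifiable:
  assumes "finite P" "eqns_over ar P" "solved_wrt P {}"
  shows "unifiable ar P"
proof -
  \<comment> \<open>The choice is unambiguous: two bindings of x would make x occur in an equation
    besides its own (\<open>uniq\<close> below).\<close>
  define \<sigma> where "\<sigma> x = (if \<exists>t. (Var x, t) \<in> P then SOME t. (Var x, t) \<in> P else Var x)" for x
  have \<sigma>_mem: "(Var x, \<sigma> x) \<in> P" if "(Var x, t) \<in> P" for x t
    using that unfolding \<sigma>_def by (auto intro: someI)
  have \<sigma>_not: "\<sigma> x = Var x" if "\<And>t. (Var x, t) \<notin> P" for x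
    using that unfolding \<sigma>_def by auto
  have uniq: "s = t" if "(Var x, s) \<in> P" "(Var x, t) \<in> P" for x s t
  proof (rule ccontr)
    assume "s \<noteq> t"
    then have "(Var x, s) \<in> P - {(Var x, t)}"
      using that by auto
    from eqns_vars_memD[OF this] have "x \<in> eqns_vars (P - {(Var x, t)})"
      by simp
    then show False
      using assms(3) that(2) by (auto simp: solved_wrt_def)
  qed
  have wf: "wf_trm ar (\<sigma> x)" for x
    using \<sigma>_mem[of x] \<sigma>_not[of x] assms(2) by (fastforce simp: eqns_over_def)
  have "{x. \<sigma> x \<noteq> Var x} \<subseteq> (\<Union>(l, r) \<in> P. vars l)"
    using \<sigma>_not by fastforce
  then have "finite {x. \<sigma> x \<noteq> Var x}"
    by (rule finite_subset) (auto simp: assms(1) finite_vars)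
  with wf have "is_subst ar \<sigma>"
    by (simp add: is_subst_def)
  moreover have "unifies \<sigma> P"
    unfolding unifies_def
  proof clarify
    fix l r assume lr: "(l, r) \<in> P"
    then obtain x where x: "l = Var x" "x \<notin> vars r" "x \<notin> eqns_vars (P - {(l, r)})"
      using assms(3) by (auto simp: solved_wrt_def)
    \<comment> \<open>If y had a binding of its own, then \<open>(l, r)\<close> would be a further
      equation containing y, against solvedness.\<close>
    have "\<sigma> y = Var y" if "y \<in> vars r" for y
    proof (rule \<sigma>_not, rule notI)
      fix t assume yt: "(Var y, t) \<in> P"
      then have "y \<notin> eqns_vars (P - {(Var y, t)})"
        using assms(3) by (auto simp: solved_wrt_def)
      moreover have "(l, r) \<in> P - {(Var y, t)}"
        using lr x that by auto
      from eqns_vars_memD[OF this] have "y \<in> eqns_vars (P - {(Var y, t)})"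
        using that by blast
      ultimately show False
        by blast
    qed
    then have "r \<cdot> \<sigma> = r"
      using subst_cong[of r \<sigma> Var] by (simp add: subst_Var)
    moreover have "\<sigma> x = r"
      using uniq \<sigma>_mem lr x(1) by blast
    ultimately show "l \<cdot> \<sigma> = r \<cdot> \<sigma>"
      using x(1) by simp
  qed
  ultimately show ?thesis
    by (auto simp: unifiable_iff_unifies)
qed

lemma vars_subst_single: "vars (r \<cdot> Var(x := t)) \<subseteq> (vars r - {x}) \<union> vars t"
  by (auto simp: vars_subst split: if_splits)

text \<open>The effect of Eliminate when its equation moves to the solved part. As x is not in t,
  the substitution removes x everywhere else. It introduces only variables of t; these occur in
  \<open>R\<close>, so none of them is a left-hand variable of \<open>P\<close>.\<close>

lemma solved_wrt_eliminate:
  fixes P R :: "('f, 'v) eqns"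
  assumes solved: "solved_wrt P R" and xt: "(Var x, t) \<in> R" and x: "x \<notin> vars t"
  defines "elim \<equiv> \<lambda>(r, s). (r \<cdot> Var(x := t), s \<cdot> Var(x := t))"
  shows "solved_wrt (insert (Var x, t) (elim ` P)) (elim ` (R - {(Var x, t)}))"
    and "eqns_vars (elim ` (R - {(Var x, t)})) \<subset> eqns_vars R"
proof -
  have elim_vars: "eqns_vars (elim ` F) \<subseteq> (eqns_vars F - {x}) \<union> vars t" for F
    unfolding eqns_vars_def elim_def using vars_subst_single[of _ x t] by fastforce
  have xR: "x \<in> eqns_vars R" and tR: "vars t \<subseteq> eqns_vars R"
    using eqns_vars_memD[OF xt] by auto
  have R': "eqns_vars (elim ` (R - {(Var x, t)})) \<subseteq> eqns_vars R - {x}"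
    using elim_vars[of "R - {(Var x, t)}"] eqns_vars_mono[of "R - {(Var x, t)}" R] x tR by blast
  with xR show "eqns_vars (elim ` (R - {(Var x, t)})) \<subset> eqns_vars R"
    by blast
  show "solved_wrt (insert (Var x, t) (elim ` P)) (elim ` (R - {(Var x, t)}))"
    unfolding solved_wrt_def
  proof clarify
    fix l r assume "(l, r) \<in> insert (Var x, t) (elim ` P)"
    then consider "l = Var x" "r = t" | l' r' where "(l', r') \<in> P" "(l, r) = elim (l', r')"
      by auto
    then show "\<exists>y. l = Var y \<and> y \<notin> vars r \<and>
        y \<notin> eqns_vars (insert (Var x, t) (elim ` P) - {(l, r)}) \<and>
        y \<notin> eqns_vars (elim ` (R - {(Var x, t)}))"
    proof cases
      case 1
      have "eqns_vars (insert (Var x, t) (elim ` P) - {(l, r)}) \<subseteq> eqns_vars (elim ` P)"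
        using 1 by (intro eqns_vars_mono) auto
      then show ?thesis
        using 1 x R' elim_vars[of P] by blast
    next
      case 2
      then obtain y where y: "l' = Var y" "y \<notin> vars r'" "y \<notin> eqns_vars (P - {(l', r')})"
          "y \<notin> eqns_vars R"
        using solved by (auto simp: solved_wrt_def)
      \<comment> \<open>Both x and the variables of t occur in \<open>R\<close>, where y does not.
        Hence \<open>elim\<close> leaves the left-hand side \<open>Var y\<close> alone.\<close>
      then have neq: "y \<noteq> x" "y \<notin> vars t"
        using xR tR by auto
      have lr: "l = Var y" "r = r' \<cdot> Var(x := t)"
        using 2(2) y(1) neq by (auto simp: elim_def)
      have "y \<notin> vars r"
        using lr vars_subst_single[of r' x t] y neq by blast
      \<comment> \<open>An image under \<open>elim\<close> that differs from \<open>(l, r)\<close>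
        comes from an equation that differs from \<open>(l', r')\<close>.\<close>
      moreover have "insert (Var x, t) (elim ` P) - {(l, r)} \<subseteq>
          insert (Var x, t) (elim ` (P - {(l', r')}))"
        using 2(2) by auto
      then have "eqns_vars (insert (Var x, t) (elim ` P) - {(l, r)}) \<subseteq>
          vars (Var x :: ('f, 'v) trm) \<union> vars t \<union> eqns_vars (elim ` (P - {(l', r')}))"
        by (metis eqns_vars_mono eqns_vars_insert)
      then have "y \<notin> eqns_vars (insert (Var x, t) (elim ` P) - {(l, r)})"
        using elim_vars[of "P - {(l', r')}"] y(3) neq by auto
      ultimately show ?thesis
        using lr R' y(4) by blast
    qed
  qed
qed

text \<open>The set is split into a solved part \<open>P\<close> and a rest \<open>R\<close>, and
  only \<open>R\<close> is measured: first by its number of variables, then by its weight. Delete,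
  Decompose and Swap lower the weight without adding variables, and Eliminate lowers the number of
  variables. An equation that is already solved moves to \<open>P\<close> without any step. When
  \<open>R\<close> is empty, \<open>P\<close> yields the unifier.\<close>

lemma synt_unif_complete_aux:
  assumes "finite P" "finite R" "eqns_over ar (P \<union> R)" "solved_wrt P R"
    and "\<not> synt_unif_fails (P \<union> R)"
  shows "unifiable ar (P \<union> R)"
  using assms
proof (induction R arbitrary: P
    rule: wf_induct_rule[OF wf_measures[of "[\<lambda>R. card (eqns_vars R), eqns_weight]"]])
  case (1 R)
  note IH = "1.IH" and finP = "1.prems"(1) and finR = "1.prems"(2)
    and over = "1.prems"(3) and solved = "1.prems"(4) and ok = "1.prems"(5)
  have disj: "P \<inter> R = {}"
    using solved by (rule solved_wrt_disjoint)
  have smaller: "(R', R) \<in> measures [\<lambda>R. card (eqns_vars R), eqns_weight]"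
    if "eqns_vars R' \<subseteq> eqns_vars R" "eqns_weight R' < eqns_weight R" for R'
    using that card_mono[OF finite_eqns_vars[OF finR] that(1)] by auto
  \<comment> \<open>Treats Delete, Decompose and Swap uniformly: they leave \<open>P\<close> as it
    is.\<close>
  have by_step: ?case if step: "synt_step (P \<union> R) (P \<union> R')" and fin: "finite R'"
    and vs: "eqns_vars R' \<subseteq> eqns_vars R" and wt: "eqns_weight R' < eqns_weight R" for R'
  proof -
    have "unifiable ar (P \<union> R')"
      using IH[OF smaller[OF vs wt] finP fin synt_step_eqns_over[OF step over]
          solved_wrt_mono[OF solved vs]] synt_unif_fails_step[OF step] ok by blast
    then show ?thesis
      using synt_step_unifies[OF step] by (auto simp: unifiable_iff_unifies)
  qed
  show ?case
  proof (cases "R = {}")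
    case True
    then show ?thesis
      using solved_unifiable[of P ar] finP over solved by simp
  next
    case False
    then obtain l r where lr: "(l, r) \<in> R" by auto
    then have diff: "P \<union> R - {(l, r)} = P \<union> (R - {(l, r)})"
      using disj by auto
    have rem: "eqns_vars (R - {(l, r)}) \<subseteq> eqns_vars R"
      by (rule eqns_vars_mono) auto
    show ?thesis
    proof (cases "l = r")
      case True
      have "synt_step (P \<union> R) (P \<union> (R - {(l, r)}))"
        using synt_step.Delete[of l "P \<union> R"] lr True diff by auto
      then show ?thesis
        using by_step rem finR lr eqns_weight_remove by blast
    next
      case neq: False
      show ?thesis
      proof (cases l)
        case (Fun f rs)
        show ?thesis
        proof (cases r)
          case (Fun g ss)
          have "g = f" "length rs = length ss"
            using ok synt_unif_failsI[of "P \<union> R"] lr \<open>l = Fun f rs\<close> Fun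
            by (auto simp: clash_def)
          note eqs = \<open>l = Fun f rs\<close> Fun this
          define R' where "R' = R - {(l, r)} \<union> set (zip rs ss)"
          have "synt_step (P \<union> R) (P \<union> R')"
            using synt_step.Decompose[of f rs ss "P \<union> R"] lr eqs diff
            by (auto simp: R'_def Un_assoc)
          moreover have "eqns_vars R' \<subseteq> eqns_vars R"
            unfolding R'_def eqns_vars_Un
            using rem eqns_vars_zip[of rs ss f] eqns_vars_memD[OF lr] eqs by blast
          moreover have "eqns_weight R' < eqns_weight R"
            unfolding R'_def using finR lr eqs eqns_weight_zip
            by (intro eqns_weight_replace) auto
          ultimately show ?thesis
            using by_step[of R'] finR by (simp add: R'_def)
        next
          case (Var x)
          define R' where "R' = R - {(l, r)} \<union> {(r, l)}"
          have "synt_step (P \<union> R) (P \<union> R')"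
            using synt_step.Swap[of l x "P \<union> R"] lr Var \<open>l = Fun f rs\<close> diff
            by (auto simp: R'_def)
          moreover have "eqns_vars R' \<subseteq> eqns_vars R"
            unfolding R'_def eqns_vars_Un
            using rem eqns_vars_memD[OF lr] by (auto simp: eqns_vars_def)
          \<comment> \<open>The left-hand side counts twice, and a non-variable term, even a
            constant, has size at least 2, whereas a variable has size 1.\<close>
          moreover have "eqns_weight R' < eqns_weight R"
            unfolding R'_def using finR lr Var \<open>l = Fun f rs\<close>
            by (intro eqns_weight_replace) (auto simp: eqns_weight_def)
          ultimately show ?thesis
            using by_step[of R'] finR by (simp add: R'_def)
        qed
      next
        case (Var x)
        have x: "x \<notin> vars r"
        proof
          assume "x \<in> vars r"
          then have "occurs_check (P \<union> R)"
            unfolding occurs_check_def using lr Var neq by blast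
          then show False
            using ok synt_unif_failsI by blast
        qed
        show ?thesis
        proof (cases "x \<in> eqns_vars (P \<union> R - {(l, r)})")
          case False
          \<comment> \<open>Eliminate does not apply, because x occurs nowhere else. The equation
            changes sides and the union stays the same, so that not failing carries over.\<close>
          have "solved_wrt (insert (l, r) P) (R - {(l, r)})"
            unfolding solved_wrt_def
          proof clarify
            fix a b assume ab: "(a, b) \<in> insert (l, r) P"
            show "\<exists>y. a = Var y \<and> y \<notin> vars b \<and> y \<notin> eqns_vars (insert (l, r) P - {(a, b)}) \<and>
                y \<notin> eqns_vars (R - {(l, r)})"
            proof (cases "(a, b) = (l, r)")
              case True
              have "insert (l, r) P - {(l, r)} \<subseteq> P \<union> R - {(l, r)}"
                  "R - {(l, r)} \<subseteq> P \<union> R - {(l, r)}"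
                by auto
              then have "x \<notin> eqns_vars (insert (l, r) P - {(l, r)})"
                  "x \<notin> eqns_vars (R - {(l, r)})"
                using False eqns_vars_mono by blast+
              then show ?thesis
                using True Var x by blast
            next
              case neq: False
              then obtain y where y: "a = Var y" "y \<notin> vars b" "y \<notin> eqns_vars (P - {(a, b)})"
                  "y \<notin> eqns_vars R"
                using ab solved by (auto simp: solved_wrt_def)
              moreover have "insert (l, r) P - {(a, b)} = insert (l, r) (P - {(a, b)})"
                using neq by auto
              ultimately show ?thesis
                using rem eqns_vars_memD[OF lr] by (auto simp: eqns_vars_insert)
            qed
          qed
          moreover have "insert (l, r) P \<union> (R - {(l, r)}) = P \<union> R"
            using lr by auto
          ultimately show ?thesis
            using IH[OF smaller[OF rem eqns_weight_remove[OF finR lr]], of "insert (l, r) P"]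
              finP finR over ok by simp
        next
          case True
          define elim :: "('a, 'b) eqn \<Rightarrow> ('a, 'b) eqn"
            where "elim = (\<lambda>(r', s). (r' \<cdot> Var(x := r), s \<cdot> Var(x := r)))"
          define P' where "P' = insert (Var x, r) (elim ` P)"
          define R' where "R' = elim ` (R - {(Var x, r)})"
          have "(Var x, r) \<in> R"
            using lr Var by simp
          note elim = solved_wrt_eliminate[OF solved this x, folded elim_def, folded P'_def R'_def]
          have "synt_step (P \<union> R) (insert (Var x, r) (elim ` (P \<union> R - {(Var x, r)})))"
            unfolding elim_def using lr Var True x by (intro synt_step.Eliminate) auto
          also have "insert (Var x, r) (elim ` (P \<union> R - {(Var x, r)})) = P' \<union> R'"
            using diff Var by (auto simp: P'_def R'_def)
          finally have step: "synt_step (P \<union> R) (P' \<union> R')" .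
          \<comment> \<open>The substitution may increase the weight, but x has left
            \<open>R\<close> and no new variable has entered.\<close>
          have "(R', R) \<in> measures [\<lambda>R. card (eqns_vars R), eqns_weight]"
            using psubset_card_mono[OF finite_eqns_vars[OF finR] elim(2)] by simp
          then have "unifiable ar (P' \<union> R')"
            by (rule IH)
              (use finP finR elim(1) ok synt_step_eqns_over[OF step over]
                synt_unif_fails_step[OF step] in \<open>auto simp: P'_def R'_def\<close>)
          then show ?thesis
            using synt_step_unifies[OF step] by (auto simp: unifiable_iff_unifies)
        qed
      qed
    qed
  qed
qed

lemma synt_unif_complete:
  assumes "finite E" "eqns_over ar E" "\<not> synt_unif_fails E"
  shows "unifiable ar E"
  using synt_unif_complete_aux[of "{}" E ar] assms by (simp add: solved_wrt_def)

section \<open>Existence of an outcome\<close>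

fun subterms :: "('f, 'v) trm \<Rightarrow> ('f, 'v) trm set" where
  "subterms (Var x) = {Var x}"
| "subterms (Fun f ts) = insert (Fun f ts) (\<Union>t \<in> set ts. subterms t)"

definition subterm_closed :: "('f, 'v) trm set \<Rightarrow> bool" where
  "subterm_closed T \<longleftrightarrow> (\<forall>f ts. Fun f ts \<in> T \<longrightarrow> set ts \<subseteq> T)"

lemma subterms_refl: "t \<in> subterms t"
  by (cases t) auto

lemma finite_subterms: "finite (subterms t)"
  by (induction t) auto

lemma subterm_closed_subterms: "subterm_closed (subterms t)"
proof (induction t)
  case (Fun g us)
  have "set ts \<subseteq> subterms (Fun g us)" if mem: "Fun f ts \<in> subterms (Fun g us)" for f ts
  proof (cases "Fun f ts = Fun g us")
    case True
    then show ?thesis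
      using subterms_refl by auto
  next
    case False
    then obtain u where u: "u \<in> set us" "Fun f ts \<in> subterms u"
      using mem by auto
    then have "set ts \<subseteq> subterms u"
      using Fun.IH by (simp add: subterm_closed_def)
    then show ?thesis
      using u(1) by auto
  qed
  then show ?case
    by (simp add: subterm_closed_def)
qed (simp add: subterm_closed_def)

text \<open>Supplies the finite box \<open>T \<times> T\<close> that saturation never leaves:
  Decomposition passes to arguments, and the remaining rules only recombine sides of existing
  equations.\<close>

lemma finite_subterm_closed_cover:
  assumes "finite U"
  obtains T where "finite T" "subterm_closed T" "U \<subseteq> T \<times> T"
proof
  let ?T = "\<Union>(r, s) \<in> U. subterms r \<union> subterms s"
  show "finite ?T"
    using assms by (auto simp: finite_subterms)
  show "subterm_closed ?T"
    using subterm_closed_subterms unfolding subterm_closed_def by fast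
  show "U \<subseteq> ?T \<times> ?T"
    using subterms_refl by fast
qed

lemma basic_step_subset:
  assumes "basic_step U V" "subterm_closed T" "U \<subseteq> T \<times> T"
  shows "V \<subseteq> T \<times> T"
  using assms
proof (induction rule: basic_step.induct)
  case (Decomposition f rs ss U)
  then have "set rs \<subseteq> T" "set ss \<subseteq> T"
    by (auto simp: subterm_closed_def)
  then have "set (zip rs ss) \<subseteq> T \<times> T"
    by (auto dest: set_zip_leftD set_zip_rightD)
  then show ?case
    using Decomposition by blast
qed auto

section \<open>Termination of the rules other than Transitivity\<close>

definition proper_var_eqns :: "('f, 'v) trm set \<Rightarrow> ('f, 'v) eqns" where
  "proper_var_eqns T = {(Var x, Var y) | x y. x \<noteq> y \<and> Var x \<in> T \<and> Var y \<in> T}"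

text \<open>
  Orient-2 raises the weight, but it adds an equation between distinct variables, and such
  equations are never removed.
\<close>

lemma basic_step_decreases:
  assumes "basic_step U V" "finite T" "U \<subseteq> T \<times> T"
  shows "(V, U) \<in> measures [\<lambda>U. card (proper_var_eqns T - U), eqns_weight]"
proof -
  have finU: "finite U"
    using assms(2,3) by (meson finite_SigmaI finite_subset)
  have "proper_var_eqns T \<subseteq> T \<times> T"
    by (auto simp: proper_var_eqns_def)
  then have finN: "finite (proper_var_eqns T - U)"
    using assms(2) by (meson finite_Diff finite_SigmaI finite_subset)
  have dec: "(V', U) \<in> measures [\<lambda>U. card (proper_var_eqns T - U), eqns_weight]"
    if "proper_var_eqns T - V' \<subseteq> proper_var_eqns T - U" "eqns_weight V' < eqns_weight U" for V'
    using that card_mono[OF finN that(1)] by auto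
  show ?thesis
    using assms(1)
  proof (cases rule: basic_step.cases)
    case (Decomposition f rs ss)
    have "eqns_weight V < eqns_weight U"
      unfolding Decomposition(1) using finU Decomposition eqns_weight_zip
      by (intro eqns_weight_replace) auto
    then show ?thesis
      by (intro dec) (auto simp: Decomposition(1) proper_var_eqns_def)
  next
    case (Orient_1 r x)
    then obtain f rs where r: "r = Fun f rs"
      by (cases r) auto
    have "eqns_weight V < eqns_weight U"
      unfolding Orient_1(1) using finU Orient_1 r
      by (intro eqns_weight_replace) (auto simp: eqns_weight_def)
    then show ?thesis
      by (intro dec) (auto simp: Orient_1(1) proper_var_eqns_def r)
  next
    case (Orient_2 y x)
    \<comment> \<open>Here x and y are distinct, since otherwise the flipped equation would already
      be in \<open>U\<close>.\<close>
    have "(Var x, Var y) \<in> proper_var_eqns T - U"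
      using Orient_2 assms(3) unfolding proper_var_eqns_def by blast
    then have "proper_var_eqns T - V \<subset> proper_var_eqns T - U"
      unfolding Orient_2(1) by blast
    then show ?thesis
      using psubset_card_mono[OF finN] by simp
  next
    case (Reflexive t)
    then show ?thesis
      using finU by (intro dec) (auto simp: proper_var_eqns_def intro: eqns_weight_remove)
  qed
qed

lemma basic_normal_form_exists:
  assumes "finite T" "subterm_closed T" "U \<subseteq> T \<times> T"
  obtains V where "basic_step\<^sup>*\<^sup>* U V" "\<nexists>W. basic_step V W" "V \<subseteq> T \<times> T"
proof -
  have "\<exists>V. basic_step\<^sup>*\<^sup>* U V \<and> (\<nexists>W. basic_step V W) \<and> V \<subseteq> T \<times> T"
    using assms(3)
  proof (induction U rule: wf_induct_rule[OF
        wf_measures[of "[\<lambda>U. card (proper_var_eqns T - U), eqns_weight]"]])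
    case (1 U)
    show ?case
    proof (cases "\<exists>W. basic_step U W")
      case True
      then obtain W where W: "basic_step U W" by blast
      show ?thesis
        using "1.IH"[OF basic_step_decreases[OF W assms(1) "1.prems"]
            basic_step_subset[OF W assms(2) "1.prems"]] W
        by (meson converse_rtranclp_into_rtranclp)
    qed (use 1 in blast)
  qed
  then show ?thesis
    using that by blast
qed

section \<open>Termination of saturation\<close>

definition proper_var_lhs :: "('f, 'v) eqns \<Rightarrow> bool" where
  "proper_var_lhs U \<longleftrightarrow> (\<forall>(l, r) \<in> U. is_Var l \<and> l \<noteq> r)"

text \<open>Any other equation would allow Reflexive, Orient-1 or Decomposition, or would be a
  clash.\<close>

lemma basic_normal_proper_var_lhs:
  assumes "\<nexists>V. basic_step U V" "\<not> clash U"
  shows "proper_var_lhs U"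
  unfolding proper_var_lhs_def
proof clarify
  fix l r assume lr: "(l, r) \<in> U"
  have "l \<noteq> r"
    using lr assms(1) by (auto intro: basic_step.Reflexive)
  moreover have "is_Var l"
  proof (rule ccontr)
    assume l: "\<not> is_Var l"
    then obtain f rs where f: "l = Fun f rs"
      by (cases l) auto
    show False
    proof (cases r)
      case (Var x)
      then show False
        using l lr assms(1) by (auto dest: basic_step.Orient_1)
    next
      case (Fun g ss)
      then have "g = f" "length rs = length ss"
        using lr f assms(2) by (auto simp: clash_def)
      then show False
        using lr f Fun assms(1) by (auto dest: basic_step.Decomposition)
    qed
  qed
  ultimately show "is_Var l \<and> l \<noteq> r"
    by blast
qed

text \<open>Decomposition and Orient-1 delete only equations with a non-variable left-hand side,
  Reflexive deletes only trivial ones, and Orient-2 deletes nothing.\<close>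

lemma basic_step_keeps:
  assumes "basic_step V W" "proper_var_lhs U" "U \<subseteq> V"
  shows "U \<subseteq> W"
  using assms
proof (induction rule: basic_step.induct)
  case (Orient_1 r x V)
  then show ?case by (auto simp: proper_var_lhs_def)
qed (fastforce simp: proper_var_lhs_def)+

lemma basic_steps_keep:
  assumes "basic_step\<^sup>*\<^sup>* V W" "proper_var_lhs U" "U \<subseteq> V"
  shows "U \<subseteq> W"
  using assms by (induction rule: rtranclp_induct) (auto dest: basic_step_keeps)

lemma basic_steps_sat_steps: "basic_step\<^sup>*\<^sup>* U V \<Longrightarrow> sat_step\<^sup>*\<^sup>* U V"
  by (erule mono_rtranclp[rule_format, rotated]) (simp add: sat_step_def)

text \<open>Induction on the number of pairs of \<open>T \<times> T\<close> missing from
  \<open>U\<close>. A Transitivity step that does not lead back to \<open>U\<close> is followed by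
  reduction to a normal form \<open>W\<close>. The equations of \<open>U\<close> survive this
  reduction, and \<open>W = U\<close> is excluded because it would be a way back; so fewer pairs are
  missing from \<open>W\<close>.\<close>

lemma normal_clash_or_saturated:
  assumes "finite T" "subterm_closed T" "U \<subseteq> T \<times> T" "\<nexists>V. basic_step U V"
  shows "\<exists>V. sat_step\<^sup>*\<^sup>* U V \<and> (clash V \<or> saturated V)"
  using assms(3,4)
proof (induction "card (T \<times> T - U)" arbitrary: U rule: less_induct)
  case less
  show ?case
  proof (cases "clash U \<or> saturated U")
    case False
    \<comment> \<open>As \<open>U\<close> is normal and free of clashes, only the Transitivity
      clause of \<open>saturated\<close> can fail.\<close>
    then obtain V where V: "trans_step U V" "\<not> basic_step\<^sup>*\<^sup>* V U"
      using less.prems(2) by (auto simp: saturated_def)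
    have "U \<subseteq> V" "V \<subseteq> T \<times> T"
      using V(1) less.prems(1) by (auto elim!: trans_step.cases)
    then obtain W where W: "basic_step\<^sup>*\<^sup>* V W" "\<nexists>X. basic_step W X" "W \<subseteq> T \<times> T"
      using basic_normal_form_exists[OF assms(1,2)] by metis
    have "U \<subseteq> W"
      using basic_steps_keep[OF W(1) basic_normal_proper_var_lhs \<open>U \<subseteq> V\<close>] less.prems(2) False
      by blast
    moreover have "U \<noteq> W"
      using V(2) W(1) by blast
    ultimately have "T \<times> T - W \<subset> T \<times> T - U"
      using W(3) by blast
    then have "card (T \<times> T - W) < card (T \<times> T - U)"
      using assms(1) by (intro psubset_card_mono) auto
    then obtain X where "sat_step\<^sup>*\<^sup>* W X" "clash X \<or> saturated X"
      using less.hyps W by blast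
    moreover have "sat_step\<^sup>*\<^sup>* U W"
      using V(1) basic_steps_sat_steps[OF W(1)]
      by (meson converse_rtranclp_into_rtranclp sat_step_def)
    ultimately show ?thesis
      by (meson rtranclp_trans)
  qed blast
qed

text \<open>The induction above starts from a normal form, so the rules other than Transitivity are
  exhausted once beforehand.\<close>

lemma clash_or_saturated:
  assumes "finite U"
  obtains V where "sat_step\<^sup>*\<^sup>* U V" "clash V \<or> saturated V"
proof -
  obtain T where T: "finite T" "subterm_closed T" "U \<subseteq> T \<times> T"
    using assms by (rule finite_subterm_closed_cover)
  then obtain W where W: "basic_step\<^sup>*\<^sup>* U W" "\<nexists>X. basic_step W X" "W \<subseteq> T \<times> T"
    by (rule basic_normal_form_exists)
  then show ?thesis
    using normal_clash_or_saturated[OF T(1,2)] basic_steps_sat_steps that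
    by (meson rtranclp_trans)
qed

section \<open>Storing, and existence of an outcome\<close>

lemma store_normal_form_exists:
  assumes "finite A"
  shows "\<exists>S' A'. (store_step \<Theta>)\<^sup>*\<^sup>* (S, A) (S', A') \<and> (\<nexists>C. store_step \<Theta> (S', A') C)"
  using assms
proof (induction "card A" arbitrary: S A rule: less_induct)
  case less
  show ?case
  proof (cases "\<exists>C. store_step \<Theta> (S, A) C")
    case True
    then obtain y r where yr: "(Var y, r) \<in> A"
      and step: "store_step \<Theta> (S, A) (insert (Var y, r) S, A - {(Var y, r)})"
      by (auto elim!: store_step.cases intro: store_step.Store)
    \<comment> \<open>Storing terminates because each step takes an equation out of the finite
      active set.\<close>
    have "card (A - {(Var y, r)}) < card A"
      using yr less.prems by (rule card_Diff1_less[rotated])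
    then show ?thesis
      using less.hyps[of "A - {(Var y, r)}" "insert (Var y, r) S"] less.prems step
      by (meson converse_rtranclp_into_rtranclp finite_Diff)
  qed blast
qed

lemma theta_outcome_exists:
  assumes "finite U"
  shows "\<exists>C. theta_outcome \<Theta> U C"
proof -
  obtain V where V: "sat_step\<^sup>*\<^sup>* U V" "clash V \<or> saturated V"
    using assms by (rule clash_or_saturated)
  show ?thesis
  proof (cases "clash V")
    case True
    then show ?thesis
      using V(1) theta_outcome.Clash by blast
  next
    case False
    have "finite V"
      using V(1) assms by (rule sat_steps_finite)
    then show ?thesis
      using store_normal_form_exists[of V \<Theta> "{}"] False V
        theta_outcome.Synt_fail theta_outcome.Success by metis
  qed
qed

section \<open>Unifiability of the input\<close>

lemma store_step_union: "store_step \<Theta> C D \<Longrightarrow> fst D \<union> snd D = fst C \<union> snd C"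
  by (induction rule: store_step.induct) auto

lemma store_steps_union:
  "(store_step \<Theta>)\<^sup>*\<^sup>* C D \<Longrightarrow> fst D \<union> snd D = fst C \<union> snd C"
  by (induction rule: rtranclp_induct) (simp_all add: store_step_union)

theorem theorem4:
  fixes ar :: "'f \<Rightarrow> nat"
    and \<Theta> :: "('f, 'v :: {countable, infinite}) schema"
    and U :: "('f, 'v) eqns"
  assumes "subst_schema ar \<Theta>"
    and "finite U"
    and "eqns_over ar U"
    and "store \<Theta> U \<noteq> None"
  shows "unifiable ar U"
proof -
  obtain S A where "fin \<Theta> U = Some (S, A)"
    using assms(4) by (auto simp: store_def)
  moreover have "theta_outcome \<Theta> U (fin \<Theta> U)"
    unfolding fin_def using theta_outcome_exists[OF assms(2)] by (rule someI_ex)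
  ultimately have "theta_outcome \<Theta> U (Some (S, A))"
    by simp
  \<comment> \<open>Among the rules for outcomes, only Success yields a \<open>Some\<close>.\<close>
  then obtain V where V: "sat_step\<^sup>*\<^sup>* U V" "(store_step \<Theta>)\<^sup>*\<^sup>* ({}, V) (S, A)"
      "\<not> synt_unif_fails (S \<union> A)"
    by (auto elim: theta_outcome.cases)
  \<comment> \<open>Storing starts from the empty store, so the union is still the saturated
    set.\<close>
  have "S \<union> A = V"
    using store_steps_union[OF V(2)] by simp
  moreover have "finite V"
    using V(1) assms(2) by (rule sat_steps_finite)
  ultimately have "unifiable ar V"
    using synt_unif_complete sat_steps_eqns_over[OF V(1) assms(3)] V(3) by blast
  then show ?thesis
    using sat_steps_unifies[OF V(1)] by (auto simp: unifiable_iff_unifies)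
qed

end
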